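(* Let $G_1=(\{0,\dots,n-1\},E_1)$ and $G_2=(\{0,\dots,n-1\},E_2)$ be simple graphs without vertices of degree $0$, and let $k=2n+4$. Then $G_1$ and $G_2$ are isomorphic if and only if there exists an automorphism $A$ of the cube $k^2$ with $s^{G_1}(v)=s^{G_2}(A(v))$ for all $v\in[k]^2$.
   Context: For a simple graph $G=(\{0,\dots,n-1\},E)$ and $k=2n+4$, the coloring $s^G:[k]^2\to\{0,1\}$ (where $[k]=\{0,\dots,k-1\}$) is defined by $s^G([i,j])=1$ if $[i,j]=[n,n]$, or $[i,j]=[n,n+1]$, or ($i,j\le n-1$ and $\{i,j\}\in E$); otherwise $s^G([i,j])=0$. A set of $k$ distinct points of $[k]^2$ is a line if it can be ordered $(q^1,\dots,q^k)$ such that in each coordinate the sequence of values is strictly increasing, strictly decreasing or constant, with at least one coordinate non-constant. An automorphism of the cube $k^2$ is a permutation of $[k]^2$ mapping every line onto a line. *)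

theory Defs
  imports Main
begin

definition simple_graph :: "nat \<Rightarrow> nat set set \<Rightarrow> bool" where
  "simple_graph n E \<longleftrightarrow> (\<forall>e\<in>E. e \<subseteq> {..<n} \<and> card e = 2)"

definition degree :: "nat set set \<Rightarrow> nat \<Rightarrow> nat" where
  "degree E v = card {e \<in> E. v \<in> e}"

definition graphs_isomorphic :: "nat \<Rightarrow> nat set set \<Rightarrow> nat set set \<Rightarrow> bool" where
  "graphs_isomorphic n E1 E2 \<longleftrightarrow>
     (\<exists>f. bij_betw f {..<n} {..<n} \<and>
          (\<forall>i<n. \<forall>j<n. {i, j} \<in> E1 \<longleftrightarrow> {f i, f j} \<in> E2))"

definition graph_coloring :: "nat \<Rightarrow> nat set set \<Rightarrow> nat \<times> nat \<Rightarrow> nat" where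
  "graph_coloring n E = (\<lambda>(i, j).
     if (i, j) = (n, n) \<or> (i, j) = (n, n + 1) \<or> (i < n \<and> j < n \<and> {i, j} \<in> E)
     then 1 else 0)"

definition cube2 :: "nat \<Rightarrow> (nat \<times> nat) set" where
  "cube2 k = {..<k} \<times> {..<k}"

definition constant_seq :: "nat \<Rightarrow> (nat \<Rightarrow> nat) \<Rightarrow> bool" where
  "constant_seq k x \<longleftrightarrow> (\<exists>c. \<forall>t<k. x t = c)"

definition monotone_seq :: "nat \<Rightarrow> (nat \<Rightarrow> nat) \<Rightarrow> bool" where
  "monotone_seq k x \<longleftrightarrow>
     strict_mono_on {..<k} x \<or> strict_antimono_on {..<k} x \<or> constant_seq k x"

text \<open>The ordering of the points is indexed from \<open>0\<close> to \<open>k - 1\<close>.\<close>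

definition is_line :: "nat \<Rightarrow> (nat \<times> nat) set \<Rightarrow> bool" where
  "is_line k L \<longleftrightarrow> L \<subseteq> cube2 k \<and>
     (\<exists>q. bij_betw q {..<k} L \<and>
          monotone_seq k (fst \<circ> q) \<and> monotone_seq k (snd \<circ> q) \<and>
          (\<not> constant_seq k (fst \<circ> q) \<or> \<not> constant_seq k (snd \<circ> q)))"

text \<open>Only the values of \<open>A\<close> on the cube matter; \<open>A\<close> is arbitrary elsewhere.\<close>

definition cube_automorphism :: "nat \<Rightarrow> (nat \<times> nat \<Rightarrow> nat \<times> nat) \<Rightarrow> bool" where
  "cube_automorphism k A \<longleftrightarrow>
     bij_betw A (cube2 k) (cube2 k) \<and> (\<forall>L. is_line k L \<longrightarrow> is_line k (A ` L))"

end

theory Submission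
  imports Defs
begin

text \<open>
  The lines of the square are its rows, its columns and the two diagonals. A diagonal is disjoint
  from at most one other line, a row or column from at least two; hence an automorphism permutes
  the rows and columns among themselves, acts as a product of two permutations up to
  transposition, and preserves the union of the diagonals. On that union only \<open>(n, n)\<close> has
  colour 1, so it is fixed, the main diagonal is preserved and both permutations coincide. The
  second marker \<open>(n, n + 1)\<close> then rules out the transposition. Conversely, a graph isomorphism
  extends to a permutation commuting with \<open>t \<mapsto> k - 1 - t\<close>, and such a permutation acts
  diagonally as an automorphism.
\<close>

section \<open>Lines of the square\<close>

definition row :: "nat \<Rightarrow> nat \<Rightarrow> (nat \<times> nat) set" where
  "row k i = (\<lambda>t. (i, t)) ` {..<k}"

definition col :: "nat \<Rightarrow> nat \<Rightarrow> (nat \<times> nat) set" where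
  "col k i = (\<lambda>t. (t, i)) ` {..<k}"

definition diag :: "nat \<Rightarrow> (nat \<times> nat) set" where
  "diag k = (\<lambda>t. (t, t)) ` {..<k}"

definition antidiag :: "nat \<Rightarrow> (nat \<times> nat) set" where
  "antidiag k = (\<lambda>t. (t, k - 1 - t)) ` {..<k}"

text \<open>Rows and columns form one family because an automorphism may exchange the two kinds;
  only their union is invariant.\<close>

definition axes :: "nat \<Rightarrow> (nat \<times> nat) set set" where
  "axes k = row k ` {..<k} \<union> col k ` {..<k}"

lemma mem_row: "(a, b) \<in> row k i \<longleftrightarrow> a = i \<and> b < k"
  by (auto simp: row_def)

lemma mem_col: "(a, b) \<in> col k i \<longleftrightarrow> a < k \<and> b = i"
  by (auto simp: col_def)

lemma mem_diag: "(a, b) \<in> diag k \<longleftrightarrow> a < k \<and> b = a"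
  by (auto simp: diag_def)

lemma mem_antidiag: "(a, b) \<in> antidiag k \<longleftrightarrow> a < k \<and> b = k - 1 - a"
  by (auto simp: antidiag_def)

lemmas mem_line_simps = mem_row mem_col mem_diag mem_antidiag

section \<open>Monotone self-maps of an initial segment\<close>

text \<open>Each step raises the value by at least 1. Counting up from 0 gives
  \<open>t \<le> x t\<close>; counting on to the last index, where the value is at most
  \<open>k - 1\<close>, gives \<open>x t \<le> t\<close>.\<close>

lemma strict_mono_on_lessThan_eq:
  fixes x :: "nat \<Rightarrow> nat"
  assumes mono: "strict_mono_on {..<k} x" and bound: "\<forall>t<k. x t < k" and "t < k"
  shows "x t = t"
proof -
  have lower: "s \<le> x s" if "s < k" for s
    using that
  proof (induction s)
    case (Suc s)
    then have "x s < x (Suc s)"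
      using mono by (auto simp: strict_mono_on_def)
    with Suc show ?case by simp
  qed simp
  have upper: "x s + d \<le> x (s + d)" if "s + d < k" for s d
    using that
  proof (induction d)
    case (Suc d)
    then have "x (s + d) < x (s + Suc d)"
      using mono by (auto simp: strict_mono_on_def)
    with Suc show ?case by simp
  qed simp
  have "x t + (k - 1 - t) \<le> x (k - 1)"
    using upper[of t "k - 1 - t"] \<open>t < k\<close> by simp
  moreover have "x (k - 1) < k"
    using bound \<open>t < k\<close> by simp
  ultimately show ?thesis
    using lower[OF \<open>t < k\<close>] \<open>t < k\<close> by linarith
qed

text \<open>Reflecting the values by \<open>k - 1 - x s\<close> reduces this to the increasing
  case.\<close>

lemma strict_antimono_on_lessThan_eq:
  fixes x :: "nat \<Rightarrow> nat"
  assumes anti: "strict_antimono_on {..<k} x" and bound: "\<forall>t<k. x t < k" and "t < k"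
  shows "x t = k - 1 - t"
proof -
  have "strict_mono_on {..<k} (\<lambda>s. k - 1 - x s)"
  proof (rule strict_mono_onI)
    fix r s assume "r \<in> {..<k}" "s \<in> {..<k}" "r < s"
    then have "x s < x r" "x r < k"
      using anti bound by (auto simp: monotone_on_def)
    then show "k - 1 - x r < k - 1 - x s" by simp
  qed
  moreover have "\<forall>s<k. k - 1 - x s < k" by auto
  ultimately have "k - 1 - x t = t"
    using \<open>t < k\<close> by (rule strict_mono_on_lessThan_eq)
  moreover have "x t < k" using bound \<open>t < k\<close> by simp
  ultimately show ?thesis by linarith
qed

lemma monotone_seq_cases:
  assumes "monotone_seq k x" and "\<forall>t<k. x t < k"
  obtains "\<forall>t<k. x t = t" | "\<forall>t<k. x t = k - 1 - t" | "constant_seq k x"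
  using assms strict_mono_on_lessThan_eq strict_antimono_on_lessThan_eq
  unfolding monotone_seq_def by blast

text \<open>Reversing the order of traversal does not change the set of points; this identifies the
  two orderings of a line.\<close>

lemma reflected_image: "(\<lambda>t. f (k - 1 - t)) ` {..<k} = f ` {..<k}" for k :: nat
proof -
  have "(\<lambda>t. k - 1 - t) ` {..<k} = {..<k}"
  proof (intro equalityI subsetI)
    fix s assume "s \<in> {..<k}"
    then have "s = k - 1 - (k - 1 - s)" "k - 1 - s \<in> {..<k}" by auto
    then show "s \<in> (\<lambda>t. k - 1 - t) ` {..<k}" by blast
  qed auto
  then show ?thesis by (metis image_image)
qed

section \<open>Classification of lines\<close>

text \<open>Each coordinate is the identity, the reflection or constant. Of the nine combinations,
  both constant is excluded; the other eight give a row, a column or a diagonal, each traversed in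
  one of two directions.\<close>

lemma is_line_cases:
  assumes "is_line k L"
  shows "L \<in> axes k \<or> L = diag k \<or> L = antidiag k"
proof -
  obtain q where sub: "L \<subseteq> cube2 k" and q: "bij_betw q {..<k} L"
    and mono: "monotone_seq k (fst \<circ> q)" "monotone_seq k (snd \<circ> q)"
    and nonconst: "\<not> constant_seq k (fst \<circ> q) \<or> \<not> constant_seq k (snd \<circ> q)"
    using assms unfolding is_line_def by blast
  define x y where "x = fst \<circ> q" and "y = snd \<circ> q"
  have L: "L = (\<lambda>t. (x t, y t)) ` {..<k}"
    using q by (auto simp: bij_betw_def x_def y_def)
  \<comment> \<open>Over an empty index range every sequence is constant, so non-constancy excludes
    \<open>k = 0\<close>.\<close>
  have kpos: "0 < k"
    using nonconst by (auto simp: constant_seq_def intro: gr0I)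
  have bx: "\<forall>t<k. x t < k" and "by": "\<forall>t<k. y t < k"
    using sub unfolding L cube2_def by auto
  have diag: ?thesis if "\<forall>t<k. x t = t" "\<forall>t<k. y t = t"
    using that unfolding L diag_def by auto
  have antidiag: ?thesis if "\<forall>t<k. x t = t" "\<forall>t<k. y t = k - 1 - t"
    using that unfolding L antidiag_def by auto
  have antidiag': ?thesis if "\<forall>t<k. x t = k - 1 - t" "\<forall>t<k. y t = t"
  proof -
    \<comment> \<open>The second coordinate \<open>t\<close> is written as a double reflection, so
      that the whole point is a function of \<open>k - 1 - t\<close>.\<close>
    have "L = (\<lambda>t. (k - 1 - t, k - 1 - (k - 1 - t))) ` {..<k}"
      unfolding L using that by (intro image_cong) auto
    also have "\<dots> = antidiag k"
      unfolding antidiag_def by (rule reflected_image)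
    finally show ?thesis by simp
  qed
  have diag': ?thesis if "\<forall>t<k. x t = k - 1 - t" "\<forall>t<k. y t = k - 1 - t"
  proof -
    have "L = (\<lambda>t. (k - 1 - t, k - 1 - t)) ` {..<k}"
      unfolding L using that by (intro image_cong) auto
    also have "\<dots> = diag k"
      unfolding diag_def by (rule reflected_image)
    finally show ?thesis by simp
  qed
  have row: ?thesis if c: "\<forall>t<k. x t = c" and "\<forall>t<k. y t = t" for c
  proof -
    have "L = row k c"
      unfolding L row_def using that kpos by (intro image_cong) auto
    moreover have "c < k" using bx c kpos by auto
    ultimately show ?thesis by (simp add: axes_def)
  qed
  have row': ?thesis if c: "\<forall>t<k. x t = c" and "\<forall>t<k. y t = k - 1 - t" for c
  proof -
    have "L = (\<lambda>t. (c, k - 1 - t)) ` {..<k}"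
      unfolding L using that by (intro image_cong) auto
    also have "\<dots> = row k c"
      unfolding row_def by (rule reflected_image)
    finally have "L = row k c" .
    moreover have "c < k" using bx c kpos by auto
    ultimately show ?thesis by (simp add: axes_def)
  qed
  have col: ?thesis if c: "\<forall>t<k. y t = c" and "\<forall>t<k. x t = t" for c
  proof -
    have "L = col k c"
      unfolding L col_def using that by (intro image_cong) auto
    moreover have "c < k" using "by" c kpos by auto
    ultimately show ?thesis by (simp add: axes_def)
  qed
  have col': ?thesis if c: "\<forall>t<k. y t = c" and "\<forall>t<k. x t = k - 1 - t" for c
  proof -
    have "L = (\<lambda>t. (k - 1 - t, c)) ` {..<k}"
      unfolding L using that by (intro image_cong) auto
    also have "\<dots> = col k c"
      unfolding col_def by (rule reflected_image)
    finally have "L = col k c" .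
    moreover have "c < k" using "by" c kpos by auto
    ultimately show ?thesis by (simp add: axes_def)
  qed
  have mx: "monotone_seq k x" and my: "monotone_seq k y"
    and nc: "\<not> constant_seq k x \<or> \<not> constant_seq k y"
    using mono nonconst by (simp_all add: x_def y_def)
  show ?thesis
    using mx bx
  proof (cases rule: monotone_seq_cases)
    case 1
    show ?thesis
      using my "by" by (cases rule: monotone_seq_cases)
        (use 1 diag antidiag col in \<open>auto simp only: constant_seq_def\<close>)
  next
    case 2
    show ?thesis
      using my "by" by (cases rule: monotone_seq_cases)
        (use 2 diag' antidiag' col' in \<open>auto simp only: constant_seq_def\<close>)
  next
    case 3
    then obtain c where "\<forall>t<k. x t = c" by (auto simp: constant_seq_def)
    with my "by" 3 nc row row' show ?thesis
      by (cases rule: monotone_seq_cases) auto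
  qed
qed

text \<open>Injectivity of one coordinate serves twice: it makes the ordering injective and, as
  indices 0 and 1 both exist, it makes that coordinate non-constant.\<close>

lemma is_lineI:
  assumes "2 \<le> k" and L: "L = (\<lambda>t. (x t, y t)) ` {..<k}"
    and bounds: "\<forall>t<k. x t < k" "\<forall>t<k. y t < k"
    and mono: "monotone_seq k x" "monotone_seq k y"
    and inj: "inj_on x {..<k} \<or> inj_on y {..<k}"
  shows "is_line k L"
proof -
  let ?q = "\<lambda>t. (x t, y t)"
  have comps: "fst \<circ> ?q = x" "snd \<circ> ?q = y" by auto
  have "inj_on ?q {..<k}"
    using inj by (auto simp: inj_on_def)
  then have "bij_betw ?q {..<k} L"
    by (simp add: bij_betw_def L)
  moreover have "\<not> constant_seq k z" if "inj_on z {..<k}" for z :: "nat \<Rightarrow> nat"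
  proof
    assume "constant_seq k z"
    then have "z 0 = z 1" using \<open>2 \<le> k\<close> by (auto simp: constant_seq_def)
    then show False using inj_onD[OF that, of 0 1] \<open>2 \<le> k\<close> by simp
  qed
  moreover have "L \<subseteq> cube2 k"
    using bounds by (auto simp: L cube2_def)
  ultimately show ?thesis
    unfolding is_line_def using mono inj comps by metis
qed

lemma monotone_seq_basic:
  "monotone_seq k (\<lambda>t. t)" "monotone_seq k (\<lambda>t. k - 1 - t)" "monotone_seq k (\<lambda>t. c)"
  by (auto simp: monotone_seq_def constant_seq_def monotone_on_def)

text \<open>For \<open>k \<le> 1\<close> every sequence is constant and there are no lines, hence
  the bound on \<open>k\<close>.\<close>

lemma is_line_iff:
  assumes "2 \<le> k"
  shows "is_line k L \<longleftrightarrow> L \<in> axes k \<or> L = diag k \<or> L = antidiag k"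
proof
  assume "L \<in> axes k \<or> L = diag k \<or> L = antidiag k"
  then consider i where "i < k" "L = row k i" | i where "i < k" "L = col k i"
    | "L = diag k" | "L = antidiag k"
    by (auto simp: axes_def)
  then show "is_line k L"
  proof cases
    case 1
    then show ?thesis using assms monotone_seq_basic
      by (intro is_lineI[where x = "\<lambda>_. i" and y = "\<lambda>t. t"]) (auto simp: row_def)
  next
    case 2
    then show ?thesis using assms monotone_seq_basic
      by (intro is_lineI[where x = "\<lambda>t. t" and y = "\<lambda>_. i"]) (auto simp: col_def)
  next
    case 3
    then show ?thesis using assms monotone_seq_basic
      by (intro is_lineI[where x = "\<lambda>t. t" and y = "\<lambda>t. t"]) (auto simp: diag_def)
  next
    case 4
    then show ?thesis using assms monotone_seq_basic
      by (intro is_lineI[where x = "\<lambda>t. t" and y = "\<lambda>t. k - 1 - t"]) (auto simp: antidiag_def)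
  qed
qed (rule is_line_cases)

section \<open>Incidence of rows, columns and diagonals\<close>

lemma axes_subset_cube2: "L \<in> axes k \<Longrightarrow> L \<subseteq> cube2 k"
  by (auto simp: axes_def row_def col_def cube2_def)

lemma diag_subset_cube2: "diag k \<subseteq> cube2 k" "antidiag k \<subseteq> cube2 k"
  by (auto simp: diag_def antidiag_def cube2_def)

lemma row_eq_iff: "0 < k \<Longrightarrow> row k i = row k j \<longleftrightarrow> i = j"
  by (metis mem_row)

lemma col_eq_iff: "0 < k \<Longrightarrow> col k i = col k j \<longleftrightarrow> i = j"
  by (metis mem_col)

lemma row_ne_col:
  assumes "2 \<le> k" shows "row k i \<noteq> col k j"
proof
  assume "row k i = col k j"
  then have "(0, j) \<in> row k i" "(1, j) \<in> row k i"
    using assms by (simp_all add: mem_col)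
  then show False by (simp add: mem_row)
qed

text \<open>Each diagonal contains two points that differ in both coordinates, which no row or
  column does.\<close>

lemma diag_not_axes:
  assumes "2 \<le> k" shows "diag k \<notin> axes k" "antidiag k \<notin> axes k"
proof -
  show "diag k \<notin> axes k"
  proof
    assume "diag k \<in> axes k"
    moreover have "(0, 0) \<in> diag k" "(1, 1) \<in> diag k"
      using assms by (auto simp: mem_diag)
    ultimately obtain L where "L \<in> axes k" "(0, 0) \<in> L" "(1, 1) \<in> L" by blast
    then show False by (auto simp: axes_def mem_line_simps)
  qed
  show "antidiag k \<notin> axes k"
  proof
    assume "antidiag k \<in> axes k"
    moreover have "(0, k - 1) \<in> antidiag k" "(1, k - 2) \<in> antidiag k"
      using assms by (auto simp: mem_antidiag)
    ultimately obtain L where "L \<in> axes k" "(0, k - 1) \<in> L" "(1, k - 2) \<in> L" by blast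
    then show False using assms by (auto simp: axes_def mem_line_simps)
  qed
qed

lemma axes_meet_diag:
  assumes "L \<in> axes k" shows "L \<inter> diag k \<noteq> {}" "L \<inter> antidiag k \<noteq> {}"
proof -
  obtain i where i: "i < k" "L = row k i \<or> L = col k i"
    using assms by (auto simp: axes_def)
  then have "(i, i) \<in> L \<inter> diag k"
    by (auto simp: mem_line_simps)
  moreover have "(i, k - 1 - i) \<in> L \<inter> antidiag k \<or> (k - 1 - i, i) \<in> L \<inter> antidiag k"
    using i by (auto simp: mem_line_simps)
  ultimately show "L \<inter> diag k \<noteq> {}" "L \<inter> antidiag k \<noteq> {}" by blast+
qed

section \<open>Automorphisms\<close>

lemma cube_automorphism_inj: "cube_automorphism k A \<Longrightarrow> inj_on A (cube2 k)"
  by (simp add: cube_automorphism_def bij_betw_def)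

lemma cube_automorphism_axes:
  assumes aut: "cube_automorphism k A" and "3 \<le> k" and L: "L \<in> axes k"
  shows "A ` L \<in> axes k"
proof (rule ccontr)
  assume not_axis: "A ` L \<notin> axes k"
  have line: "M \<in> axes k \<Longrightarrow> is_line k (A ` M)" for M
    using aut \<open>3 \<le> k\<close> by (simp add: cube_automorphism_def is_line_iff)
  have inj: "inj_on A (cube2 k)"
    using aut by (rule cube_automorphism_inj)
  have "\<exists>M N. M \<in> axes k \<and> N \<in> axes k \<and> M \<noteq> N \<and> L \<inter> M = {} \<and> L \<inter> N = {}"
  proof -
    obtain i where i: "i < k" "L = row k i \<or> L = col k i"
      using L by (auto simp: axes_def)
    obtain a b where ab: "a < k" "b < k" "a \<noteq> b" "a \<noteq> i" "b \<noteq> i"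
    proof -
      have "\<exists>a b. a < k \<and> b < k \<and> a \<noteq> b \<and> a \<noteq> i \<and> b \<noteq> i"
      proof (cases "i = 0 \<or> i = 1")
        case True
        \<comment> \<open>Here \<open>1 - i\<close> is the other element of {0, 1}.\<close>
        with \<open>3 \<le> k\<close> show ?thesis by (intro exI[of _ "1 - i"] exI[of _ 2]) auto
      next
        case False
        with \<open>3 \<le> k\<close> show ?thesis by (intro exI[of _ 0] exI[of _ 1]) auto
      qed
      then show ?thesis using that by blast
    qed
    from i(2) show ?thesis
    proof
      assume "L = row k i"
      with ab show ?thesis
        by (intro exI[of _ "row k a"] exI[of _ "row k b"])
          (auto simp: axes_def row_eq_iff mem_row)
    next
      assume "L = col k i"
      with ab show ?thesis
        by (intro exI[of _ "col k a"] exI[of _ "col k b"])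
          (auto simp: axes_def col_eq_iff mem_col)
    qed
  qed
  then obtain M N where MN: "M \<in> axes k" "N \<in> axes k" "M \<noteq> N" "L \<inter> M = {}" "L \<inter> N = {}"
    by blast
  have disj: "A ` L \<inter> A ` K = {}" if "K \<in> axes k" "L \<inter> K = {}" for K
    using inj_on_image_Int[OF inj axes_subset_cube2[OF L] axes_subset_cube2[OF that(1)]] that(2)
    by simp
  have AL: "A ` L = diag k \<or> A ` L = antidiag k"
    using is_line_cases[OF line[OF L]] not_axis by blast
  have ne: "A ` L \<noteq> {}"
    using AL axes_meet_diag[OF L] by blast
  have other: "A ` K = (if A ` L = diag k then antidiag k else diag k)"
    if "K \<in> axes k" "L \<inter> K = {}" for K
  proof -
    have "A ` K \<notin> axes k"
      using disj[OF that] AL axes_meet_diag[of "A ` K" k] by (metis Int_commute)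
    moreover have "A ` K \<noteq> A ` L"
      using disj[OF that] ne by auto
    ultimately show ?thesis
      using is_line_cases[OF line[OF that(1)]] AL by metis
  qed
  have "A ` M = A ` N"
    using other MN by simp
  then have "M = N"
    using inj_on_image_eq_iff[OF inj axes_subset_cube2[OF MN(1)] axes_subset_cube2[OF MN(2)]]
    by simp
  with MN show False by blast
qed

text \<open>An automorphism is only required to map lines forward; finiteness of
  \<open>axes k\<close> turns injectivity into surjectivity, so nothing about the inverse of
  \<open>A\<close> has to be assumed.\<close>

lemma cube_automorphism_bij_axes:
  assumes aut: "cube_automorphism k A" and "3 \<le> k"
  shows "image A ` axes k = axes k"
proof (rule endo_inj_surj)
  show "finite (axes k)" by (simp add: axes_def)
  show "image A ` axes k \<subseteq> axes k"
    using cube_automorphism_axes[OF assms] by blast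
  show "inj_on (image A) (axes k)"
    using inj_on_image_eq_iff[OF cube_automorphism_inj[OF aut]] axes_subset_cube2
    by (auto intro!: inj_onI)
qed

text \<open>Every row and column is already the image of a row or column, so injectivity leaves only
  the diagonals as images of diagonals.\<close>

lemma cube_automorphism_diag:
  assumes aut: "cube_automorphism k A" and "3 \<le> k" and L: "L = diag k \<or> L = antidiag k"
  shows "A ` L = diag k \<or> A ` L = antidiag k"
proof -
  have "A ` L \<notin> axes k"
  proof
    assume "A ` L \<in> axes k"
    then obtain M where M: "M \<in> axes k" "A ` M = A ` L"
      using cube_automorphism_bij_axes[OF assms(1,2)] by (metis imageE)
    have "L \<subseteq> cube2 k" using L diag_subset_cube2 by auto
    then have "M = L"
      using inj_on_image_eq_iff[OF cube_automorphism_inj[OF aut] axes_subset_cube2[OF M(1)]] M(2)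
      by metis
    with M(1) L diag_not_axes[of k] \<open>3 \<le> k\<close> show False by auto
  qed
  moreover have "is_line k L"
    using L \<open>3 \<le> k\<close> by (simp add: is_line_iff)
  then have "is_line k (A ` L)"
    using aut unfolding cube_automorphism_def by blast
  ultimately show ?thesis
    using is_line_cases by blast
qed

text \<open>The image of row 0 decides all others. The other rows are disjoint from it, so their
  images cannot be columns, which meet every row. Columns meet row 0, so an image that is a row
  could only be row \<open>r\<close>, against injectivity. A point is then located by its row and
  its column.\<close>

lemma cube_automorphism_rows_to_rows:
  assumes aut: "cube_automorphism k A" and "3 \<le> k" and r: "r < k" and A0: "A ` row k 0 = row k r"
  shows "\<exists>p s. \<forall>i<k. \<forall>j<k. A (i, j) = (p i, s j)"
proof -
  have inj: "inj_on A (cube2 k)"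
    using aut by (rule cube_automorphism_inj)
  have ax: "row k i \<in> axes k" "col k i \<in> axes k" if "i < k" for i
    using that by (auto simp: axes_def)
  have k0: "0 < k" "2 \<le> k" using \<open>3 \<le> k\<close> by auto
  have int: "A ` K \<inter> A ` M = A ` (K \<inter> M)" if "K \<in> axes k" "M \<in> axes k" for K M
    using inj_on_image_Int[OF inj axes_subset_cube2[OF that(1)] axes_subset_cube2[OF that(2)]]
    by simp
  have eq: "K = M" if "A ` K = A ` M" "K \<in> axes k" "M \<in> axes k" for K M
    using inj_on_image_eq_iff[OF inj axes_subset_cube2[OF that(2)] axes_subset_cube2[OF that(3)]]
      that(1) by simp
  have "\<exists>p. A ` row k i = row k p" if i: "i < k" for i
  proof (cases "i = 0")
    case False
    then have "row k 0 \<inter> row k i = {}" by (auto simp: row_def)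
    then have disj: "row k r \<inter> A ` row k i = {}"
      using int[OF ax(1)[OF k0(1)] ax(1)[OF i]] A0 by simp
    have "A ` row k i \<noteq> col k c" if "c < k" for c
    proof
      assume "A ` row k i = col k c"
      moreover have "(r, c) \<in> row k r \<inter> col k c"
        using r that by (simp add: mem_line_simps)
      ultimately show False using disj by blast
    qed
    then show ?thesis
      using cube_automorphism_axes[OF assms(1,2) ax(1)[OF i]] by (auto simp: axes_def)
  qed (use A0 in blast)
  then obtain p where p: "\<And>i. i < k \<Longrightarrow> A ` row k i = row k (p i)" by metis
  have "\<exists>s. A ` col k j = col k s" if j: "j < k" for j
  proof -
    have "(0, j) \<in> row k 0 \<inter> col k j"
      using j k0 by (simp add: mem_line_simps)
    then have meet: "row k r \<inter> A ` col k j \<noteq> {}"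
      using A0 by blast
    have "A ` col k j \<noteq> row k c" for c
    proof
      assume c: "A ` col k j = row k c"
      then have "c = r" using meet by (auto simp: row_def)
      then have "col k j = row k 0"
        using c A0 eq ax k0 j by metis
      then show False using row_ne_col[OF k0(2)] by metis
    qed
    then show ?thesis
      using cube_automorphism_axes[OF assms(1,2) ax(2)[OF j]] by (auto simp: axes_def)
  qed
  then obtain s where s: "\<And>j. j < k \<Longrightarrow> A ` col k j = col k (s j)" by metis
  have "A (i, j) = (p i, s j)" if "i < k" "j < k" for i j
  proof -
    have "(i, j) \<in> row k i" "(i, j) \<in> col k j"
      using that by (simp_all add: mem_line_simps)
    then have "A (i, j) \<in> row k (p i)" "A (i, j) \<in> col k (s j)"
      using p s that by blast+
    then show ?thesis
      by (cases "A (i, j)") (simp add: mem_line_simps)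
  qed
  then show ?thesis by blast
qed

section \<open>Transposition and product form\<close>

lemma swap_axes: "L \<in> axes k \<Longrightarrow> prod.swap ` L \<in> axes k"
  by (auto simp: axes_def row_def col_def image_image)

lemma swap_diag: "prod.swap ` diag k = diag k" "prod.swap ` antidiag k = antidiag k"
proof -
  show "prod.swap ` diag k = diag k"
    by (simp add: diag_def image_image)
  have "prod.swap ` antidiag k = (\<lambda>t. (k - 1 - t, k - 1 - (k - 1 - t))) ` {..<k}"
    unfolding antidiag_def image_image by (intro image_cong) auto
  also have "\<dots> = antidiag k"
    unfolding antidiag_def by (rule reflected_image)
  finally show "prod.swap ` antidiag k = antidiag k" .
qed

text \<open>Allows the case of row 0 going to a column to be reduced to that of row 0 going to a
  row.\<close>

lemma cube_automorphism_swap: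
  assumes aut: "cube_automorphism k A" and "2 \<le> k"
  shows "cube_automorphism k (prod.swap \<circ> A)"
proof -
  have "bij_betw prod.swap (cube2 k) (cube2 k)"
    by (auto simp: bij_betw_def cube2_def)
  then have "bij_betw (prod.swap \<circ> A) (cube2 k) (cube2 k)"
    using aut by (auto simp: cube_automorphism_def intro: bij_betw_trans)
  moreover have "is_line k (prod.swap ` L)" if "is_line k L" for L
    using that swap_axes swap_diag is_line_iff[OF \<open>2 \<le> k\<close>] by metis
  ultimately show ?thesis
    using aut unfolding cube_automorphism_def by (metis image_comp)
qed

lemma cube_automorphism_product:
  assumes aut: "cube_automorphism k A" and "3 \<le> k"
  obtains p s where "\<forall>i<k. \<forall>j<k. A (i, j) = (p i, s j)"
  | p s where "\<forall>i<k. \<forall>j<k. A (i, j) = (s j, p i)"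
proof -
  have "row k 0 \<in> axes k" using \<open>3 \<le> k\<close> by (simp add: axes_def)
  then have "A ` row k 0 \<in> axes k"
    by (rule cube_automorphism_axes[OF assms])
  then obtain r where r: "r < k" "A ` row k 0 = row k r \<or> A ` row k 0 = col k r"
    by (auto simp: axes_def)
  from r(2) show ?thesis
  proof
    assume "A ` row k 0 = row k r"
    then show ?thesis
      using cube_automorphism_rows_to_rows[OF assms r(1)] that(1) by blast
  next
    assume "A ` row k 0 = col k r"
    then have "(prod.swap \<circ> A) ` row k 0 = prod.swap ` col k r"
      by (metis image_comp)
    also have "\<dots> = row k r"
      by (simp add: row_def col_def image_image)
    finally have "(prod.swap \<circ> A) ` row k 0 = row k r" .
    then obtain p s where "\<forall>i<k. \<forall>j<k. (prod.swap \<circ> A) (i, j) = (p i, s j)"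
      using cube_automorphism_rows_to_rows[OF cube_automorphism_swap[OF aut] _ r(1)] \<open>3 \<le> k\<close>
      by fastforce
    then have "\<forall>i<k. \<forall>j<k. A (i, j) = (s j, p i)"
      by (metis comp_apply swap_simp swap_swap)
    then show ?thesis by (rule that(2))
  qed
qed

text \<open>Any permutation acting on both coordinates preserves the rows, the columns and the main
  diagonal; commuting with the reflection is what preserves the antidiagonal.\<close>

lemma cube_automorphism_diagonal_action:
  assumes bij: "bij_betw p {..<k} {..<k}" and refl: "\<forall>t<k. p (k - 1 - t) = k - 1 - p t"
    and "2 \<le> k"
  shows "cube_automorphism k (map_prod p p)"
proof -
  have img: "p ` {..<k} = {..<k}" using bij by (simp add: bij_betw_def)
  have "bij_betw (map_prod p p) (cube2 k) (cube2 k)"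
    unfolding cube2_def using bij by (rule bij_betw_map_prod[OF _ bij])
  moreover have "is_line k (map_prod p p ` L)" if "is_line k L" for L
  proof -
    consider i where "i < k" "L = row k i" | i where "i < k" "L = col k i"
      | "L = diag k" | "L = antidiag k"
      using is_line_cases[OF \<open>is_line k L\<close>] by (auto simp: axes_def)
    then show ?thesis
    proof cases
      case 1
      then have "map_prod p p ` L = (\<lambda>t. (p i, t)) ` p ` {..<k}"
        by (simp add: row_def image_image)
      then have "map_prod p p ` L = row k (p i)" by (simp add: img row_def)
      moreover have "p i < k" using img 1 by blast
      ultimately show ?thesis using \<open>2 \<le> k\<close> by (simp add: is_line_iff axes_def)
    next
      case 2
      then have "map_prod p p ` L = (\<lambda>t. (t, p i)) ` p ` {..<k}"
        by (simp add: col_def image_image)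
      then have "map_prod p p ` L = col k (p i)" by (simp add: img col_def)
      moreover have "p i < k" using img 2 by blast
      ultimately show ?thesis using \<open>2 \<le> k\<close> by (simp add: is_line_iff axes_def)
    next
      case 3
      then have "map_prod p p ` L = (\<lambda>t. (t, t)) ` p ` {..<k}"
        by (simp add: diag_def image_image)
      then show ?thesis using \<open>2 \<le> k\<close> by (simp add: img is_line_iff diag_def)
    next
      case 4
      then have "map_prod p p ` L = (\<lambda>t. (t, k - 1 - t)) ` p ` {..<k}"
        using refl by (auto simp: antidiag_def image_image intro!: image_cong)
      then show ?thesis using \<open>2 \<le> k\<close> by (simp add: img is_line_iff antidiag_def)
    qed
  qed
  ultimately show ?thesis by (simp add: cube_automorphism_def)
qed

section \<open>Colourings of graphs\<close>

lemma graph_coloring_eq_1_iff: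
  "graph_coloring n E (i, j) = 1 \<longleftrightarrow>
    i = n \<and> (j = n \<or> j = n + 1) \<or> i < n \<and> j < n \<and> {i, j} \<in> E"
  by (auto simp: graph_coloring_def)

text \<open>Colours are only 0 or 1, so comparing the points of colour 1 suffices.\<close>

lemma graph_coloring_eqI:
  "(graph_coloring n E v = 1 \<longleftrightarrow> graph_coloring n E' w = 1) \<Longrightarrow>
    graph_coloring n E v = graph_coloring n E' w"
  by (auto simp: graph_coloring_def split: prod.splits if_splits)

text \<open>Absence of loops leaves only \<open>(n, n)\<close> on the main diagonal. On the
  antidiagonal the coordinates sum to \<open>2 * n + 3\<close>, more than at any point of colour
  1.\<close>

lemma graph_coloring_diagonals:
  assumes "simple_graph n E" and "k = 2 * n + 4" and "v \<in> diag k \<union> antidiag k"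
    and "graph_coloring n E v = 1"
  shows "v = (n, n)"
proof -
  obtain i j where v: "v = (i, j)" by (cases v)
  have "{i, i} \<notin> E"
    using assms(1) by (auto simp: simple_graph_def)
  then show ?thesis
    using assms(2-4) unfolding v graph_coloring_eq_1_iff
    by (auto simp: mem_line_simps)
qed

lemma neighbour_exists:
  assumes "simple_graph n E" and "degree E v \<noteq> 0"
  obtains w where "w < n" "v < n" "{v, w} \<in> E"
proof -
  have "{e \<in> E. v \<in> e} \<noteq> {}"
    using assms(2) unfolding degree_def by (metis card.empty)
  then obtain e where e: "e \<in> E" "v \<in> e" by blast
  then have "card e = 2" "e \<subseteq> {..<n}"
    using assms(1) by (auto simp: simple_graph_def)
  then obtain w where "e = {v, w}"
    using e by (auto simp: card_2_iff)
  with e \<open>e \<subseteq> {..<n}\<close> show ?thesis by (intro that[of w]) auto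
qed

section \<open>From automorphisms to graph isomorphisms\<close>

text \<open>The markers force \<open>A\<close> to act by one permutation \<open>p\<close> with
  \<open>p n = n\<close>. Positive degrees then confine the images of vertices to vertices, so
  \<open>p\<close> restricts to the isomorphism.\<close>

lemma isomorphism_of_automorphism:
  assumes G1: "simple_graph n E1" and G2: "simple_graph n E2"
    and deg: "\<forall>v<n. degree E1 v \<noteq> 0" and k: "k = 2 * n + 4"
    and aut: "cube_automorphism k A"
    and col: "\<forall>v\<in>cube2 k. graph_coloring n E1 v = graph_coloring n E2 (A v)"
  shows "graphs_isomorphic n E1 E2"
proof -
  have k3: "3 \<le> k" and nk: "n < k" "n + 1 < k" using k by auto
  have inj: "inj_on A (cube2 k)" using aut by (rule cube_automorphism_inj)
  have color: "graph_coloring n E2 (A (i, j)) = 1 \<longleftrightarrow> graph_coloring n E1 (i, j) = 1"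
    if "i < k" "j < k" for i j
    using col that by (simp add: cube2_def)
  have nn: "(n, n) \<in> diag k" using nk by (simp add: mem_diag)
  have Adiag: "A ` diag k = diag k \<or> A ` diag k = antidiag k"
    using cube_automorphism_diag[OF aut k3] by blast
  have fixed: "A (n, n) = (n, n)"
  proof (rule graph_coloring_diagonals[OF G2 k])
    show "A (n, n) \<in> diag k \<union> antidiag k" using Adiag nn by blast
    show "graph_coloring n E2 (A (n, n)) = 1"
      using color[OF nk(1) nk(1)] graph_coloring_eq_1_iff by blast
  qed
  have "A ` diag k = diag k"
  proof -
    have "(n, n) \<in> A ` diag k" using nn fixed by (metis imageI)
    \<comment> \<open>The antidiagonal point with first coordinate \<open>n\<close> is
      \<open>(n, n + 3)\<close>.\<close>
    moreover have "(n, n) \<notin> antidiag k" using k by (simp add: mem_antidiag)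
    ultimately show ?thesis using Adiag by metis
  qed
  then have "A (t, t) \<in> diag k" if "t < k" for t
    using that by (metis imageI mem_diag)
  then have on_diag: "fst (A (t, t)) = snd (A (t, t))" if "t < k" for t
    using that by (metis mem_diag prod.collapse)
  have color': "graph_coloring n E2 (A (n, n + 1)) = 1"
    using color[OF nk] graph_coloring_eq_1_iff by blast
  have ne: "A (n, n + 1) \<noteq> (n, n)"
    using inj_onD[OF inj, of "(n, n + 1)" "(n, n)"] fixed nk by (auto simp: cube2_def)
  obtain p where p: "\<forall>i<k. \<forall>j<k. A (i, j) = (p i, p j)"
  proof (rule cube_automorphism_product[OF aut k3])
    fix p s assume *: "\<forall>i<k. \<forall>j<k. A (i, j) = (p i, s j)"
    then have "\<forall>t<k. s t = p t" using on_diag by simp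
    with * have "\<forall>i<k. \<forall>j<k. A (i, j) = (p i, p j)" by simp
    then show thesis by (rule that)
  next
    fix p s assume *: "\<forall>i<k. \<forall>j<k. A (i, j) = (s j, p i)"
    then have "p n = n" using fixed nk by simp
    \<comment> \<open>The only point of colour 1 with second coordinate \<open>n\<close> is
      \<open>(n, n)\<close>, already the image of \<open>(n, n)\<close>; so the transposed case is
      contradictory.\<close>
    with * have "A (n, n + 1) = (s (n + 1), n)" using nk by simp
    with color' ne show thesis by (simp add: graph_coloring_eq_1_iff del: One_nat_def)
  qed
  have pn: "p n = n" using p fixed nk by simp
  have inj_p: "inj_on p {..<k}"
  proof (rule inj_onI)
    fix i j assume "i \<in> {..<k}" "j \<in> {..<k}" "p i = p j"
    then have "A (i, i) = A (j, j)" "(i, i) \<in> cube2 k" "(j, j) \<in> cube2 k"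
      using p by (auto simp: cube2_def)
    then show "i = j" using inj by (auto dest: inj_onD)
  qed
  have less: "p i < n" if i: "i < n" for i
  proof -
    \<comment> \<open>A neighbour of \<open>i\<close> yields a point of colour 1 with first
      coordinate \<open>p i\<close>, whence \<open>p i \<le> n\<close>; the value \<open>n\<close>
      is already taken by \<open>n\<close> itself.\<close>
    obtain j where j: "j < n" "{i, j} \<in> E1"
      using neighbour_exists[OF G1] deg i by metis
    then have "graph_coloring n E2 (p i, p j) = 1"
      using color[of i j] p i k by (simp add: graph_coloring_eq_1_iff del: One_nat_def)
    then have "p i \<le> n" by (auto simp: graph_coloring_eq_1_iff simp del: One_nat_def)
    moreover have "p i \<noteq> n"
      using inj_p pn i nk by (metis inj_onD lessThan_iff less_irrefl less_trans)
    ultimately show ?thesis by simp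
  qed
  have "inj_on p {..<n}" using inj_p by (rule inj_on_subset) (use k in auto)
  moreover have "p ` {..<n} \<subseteq> {..<n}" using less by blast
  ultimately have "bij_betw p {..<n} {..<n}"
    by (simp add: bij_betw_def endo_inj_surj)
  moreover have "{i, j} \<in> E1 \<longleftrightarrow> {p i, p j} \<in> E2" if "i < n" "j < n" for i j
    using color[of i j] p that less[of i] less[of j] k by (simp add: graph_coloring_eq_1_iff del: One_nat_def)
  ultimately show ?thesis
    unfolding graphs_isomorphic_def by blast
qed

section \<open>From graph isomorphisms to automorphisms\<close>

lemma automorphism_of_isomorphism:
  assumes iso: "graphs_isomorphic n E1 E2" and k: "k = 2 * n + 4"
  shows "\<exists>A. cube_automorphism k A \<and>
    (\<forall>v\<in>cube2 k. graph_coloring n E1 v = graph_coloring n E2 (A v))"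
proof -
  obtain f where f: "bij_betw f {..<n} {..<n}"
    and edges: "\<And>i j. i < n \<Longrightarrow> j < n \<Longrightarrow> {i, j} \<in> E1 \<longleftrightarrow> {f i, f j} \<in> E2"
    using iso unfolding graphs_isomorphic_def by blast
  have f_less: "f i < n" if "i < n" for i
    using f that by (auto simp: bij_betw_def)
  have f_inj: "f i = f j \<longleftrightarrow> i = j" if "i < n" "j < n" for i j
    using f that by (auto simp: bij_betw_def dest: inj_onD)
  \<comment> \<open>The reflection exchanges the lowest and the highest \<open>n\<close> values and
    maps the four middle ones to themselves. So \<open>f\<close> acts on the low block, its mirror
    image on the high block, and the middle block, which contains \<open>n\<close> and
    \<open>n + 1\<close>, is fixed pointwise.\<close>
  define p where "p i = (if i < n then f i
    else if n + 4 \<le> i then k - 1 - f (k - 1 - i) else i)" for i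
  have low: "p i = f i" if "i < n" for i using that by (simp add: p_def)
  have mid: "p i = i" if "n \<le> i" "i < n + 4" for i using that by (simp add: p_def)
  have high: "p i = k - 1 - f (k - 1 - i)" "n + 4 \<le> p i" "p i < k" "k - 1 - i < n"
    if i: "n + 4 \<le> i" "i < k" for i
  proof -
    show "p i = k - 1 - f (k - 1 - i)" using i by (simp add: p_def)
    show "k - 1 - i < n" using i k by linarith
    then have "f (k - 1 - i) < n" by (rule f_less)
    with \<open>p i = k - 1 - f (k - 1 - i)\<close> show "n + 4 \<le> p i" "p i < k" using k by linarith+
  qed
  have p_less: "p i < n \<longleftrightarrow> i < n" if "i < k" for i
    using that f_less[of i] low[of i] mid[of i] high(2)[of i] by linarith
  have p_mid: "p i = c \<longleftrightarrow> i = c" if "i < k" "n \<le> c" "c < n + 4" for i c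
    using that f_less[of i] low[of i] mid[of i] high(2)[of i] by linarith
  have refl: "\<forall>t<k. p (k - 1 - t) = k - 1 - p t"
  proof (intro allI impI)
    fix t assume t: "t < k"
    consider "t < n" | "n \<le> t" "t < n + 4" | "n + 4 \<le> t" by linarith
    then show "p (k - 1 - t) = k - 1 - p t"
    proof cases
      case 1
      then have "k - 1 - (k - 1 - t) = t" "n + 4 \<le> k - 1 - t" using k by auto
      with 1 t show ?thesis by (simp add: high(1) low)
    next
      case 2
      then have "n \<le> k - 1 - t" "k - 1 - t < n + 4" using k by auto
      with 2 show ?thesis by (simp add: mid)
    next
      case 3
      \<comment> \<open>The bound on \<open>f (k - 1 - t)\<close> makes the double truncated
        subtraction cancel.\<close>
      then have "f (k - 1 - t) < k" "k - 1 - t < n" using high(4)[OF 3 t] f_less k by fastforce+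
      with 3 t show ?thesis by (simp add: high(1) low)
    qed
  qed
  have range: "p i < k" if "i < k" for i
    using that k low[of i] mid[of i] high(3)[of i] f_less[of i] by linarith
  have "inj_on p {..<k}"
  proof (rule inj_onI)
    fix i j assume ij: "i \<in> {..<k}" "j \<in> {..<k}" and eq: "p i = p j"
    consider "i < n" | "n \<le> i" "i < n + 4" | "n + 4 \<le> i" by linarith
    then show "i = j"
    proof cases
      case 1
      then have "j < n" using p_less ij eq by (metis lessThan_iff)
      with 1 eq show ?thesis by (simp add: low f_inj)
    next
      case 2
      then show ?thesis using p_mid[of j i] mid[of i] ij eq by auto
    next
      case 3
      then have "n + 4 \<le> p j" using high(2)[of i] ij eq by simp
      then have j: "n + 4 \<le> j"
        using p_less[of j] mid[of j] ij unfolding lessThan_iff by linarith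
      \<comment> \<open>These bounds keep the subtractions from truncating, so that equal
        differences give equal values of \<open>f\<close>.\<close>
      have "f (k - 1 - i) < n" "f (k - 1 - j) < n"
        using high(4) 3 j ij f_less by auto
      then have "f (k - 1 - i) = f (k - 1 - j)"
        using high(1)[OF 3] high(1)[OF j] ij eq k unfolding lessThan_iff by linarith
      then have "k - 1 - i = k - 1 - j"
        using f_inj high(4) 3 j ij by simp
      with ij show ?thesis by auto
    qed
  qed
  moreover have "p ` {..<k} \<subseteq> {..<k}" using range by blast
  ultimately have "bij_betw p {..<k} {..<k}"
    by (simp add: bij_betw_def endo_inj_surj)
  then have "cube_automorphism k (map_prod p p)"
    using refl k by (intro cube_automorphism_diagonal_action) auto
  moreover have "graph_coloring n E1 v = graph_coloring n E2 (map_prod p p v)"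
    if v: "v \<in> cube2 k" for v
  proof -
    obtain i j where ij: "v = (i, j)" "i < k" "j < k"
      using v by (auto simp: cube2_def)
    \<comment> \<open>Both markers are preserved in both directions; the remaining points of colour
      1 are handled by \<open>edges\<close>.\<close>
    have "p i = n \<longleftrightarrow> i = n" "p j = n \<longleftrightarrow> j = n" "p j = n + 1 \<longleftrightarrow> j = n + 1"
      using p_mid ij by auto
    then have "graph_coloring n E1 (i, j) = 1 \<longleftrightarrow> graph_coloring n E2 (p i, p j) = 1"
      using p_less ij edges low by (auto simp: graph_coloring_eq_1_iff simp del: One_nat_def)
    then show ?thesis
      using graph_coloring_eqI ij by simp
  qed
  ultimately show ?thesis by blast
qed

theorem theorem8:
  fixes n k :: nat and E1 E2 :: "nat set set"
  assumes "simple_graph n E1" and "simple_graph n E2"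
    and "\<forall>v<n. degree E1 v \<noteq> 0" and "\<forall>v<n. degree E2 v \<noteq> 0"
    and "k = 2 * n + 4"
  shows "graphs_isomorphic n E1 E2 \<longleftrightarrow>
    (\<exists>A. cube_automorphism k A \<and>
         (\<forall>v\<in>cube2 k. graph_coloring n E1 v = graph_coloring n E2 (A v)))"
  using isomorphism_of_automorphism[OF assms(1-3,5)] automorphism_of_isomorphism[OF _ assms(5)]
  by blast

end
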